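(* Let $f:\mathbb{R}^n\to\mathbb{R}$ be convex and differentiable with $L$-Lipschitz continuous gradient, and let $F=f+h$ with either $h=h_{\mathrm{cons}}$ (sparsity constrained problem) or $h=h_{\mathrm{regu}}$ (sparse regularized problem). Let $k\in\{1,\dots,n\}$, with $k\ge 1$ if $h=h_{\mathrm{regu}}$ and $k\ge 2$ if $h=h_{\mathrm{cons}}$. Then the following implications hold for a point of $\mathbb{R}^n$: (a) every $L$-stationary point is a basic stationary point; (b) every block-$k$ stationary point is an $L$-stationary point; (c) every block-$(k+1)$ stationary point is a block-$k$ stationary point (for $k+1\le n$), and hence there is a chain of implications block-$k$ $\Leftarrow$ block-$(k+1)$ $\Leftarrow\cdots\Leftarrow$ block-$n$; (d) a point is a block-$n$ stationary point if and only if it is an optimal point, i.e. a global minimizer of $F$ over $\mathbb{R}^n$.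
   Context: Let $\|\mathbf{x}\|_0$ be the number of nonzero entries of $\mathbf{x}\in\mathbb{R}^n$. Fix an integer $s\in\{1,\dots,n\}$ and $\lambda>0$. Define $h_{\mathrm{cons}}(\mathbf{x})=0$ if $\|\mathbf{x}\|_0\le s$ and $h_{\mathrm{cons}}(\mathbf{x})=+\infty$ otherwise; $h_{\mathrm{regu}}(\mathbf{x})=\lambda\|\mathbf{x}\|_0$. The problem is $\min_{\mathbf{x}\in\mathbb{R}^n}F(\mathbf{x})$ with $F=f+h$. All points ("solutions") considered below are feasible, i.e. satisfy $F(\mathbf{x})<\infty$. For an index set $B\subseteq\{1,\dots,n\}$, $\bar B$ is its complement and $\mathbf{x}_B$ is the subvector of $\mathbf{x}$ indexed by $B$. Basic stationary point: for a point $\mathbf{x}$ let $Z=\{i:\mathbf{x}_i=0\}$ and $\bar Z=\{j:\mathbf{x}_j\ne0\}$. For $h=h_{\mathrm{regu}}$, $\mathbf{x}$ is a basic stationary point if $\mathbf{x}$ minimizes $f(\mathbf{y})$ over $\{\mathbf{y}:\mathbf{y}_Z=\mathbf{0}\}$. For $h=h_{\mathrm{cons}}$, $\mathbf{x}$ is a basic stationary point if $|\bar Z|\le s$ and $\mathbf{x}$ minimizes $f(\mathbf{y})$ over $\{\mathbf{y}:\mathbf{y}_Z=\mathbf{0}\}$. $L$-stationary point: $\mathbf{x}$ is an $L$-stationary point if $\mathbf{x}$ minimizes over $\mathbf{y}\in\mathbb{R}^n$ the function $g(\mathbf{y},\mathbf{x})+h(\mathbf{y})$, where $g(\mathbf{y},\mathbf{x})=f(\mathbf{x})+\langle\nabla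 f(\mathbf{x}),\mathbf{y}-\mathbf{x}\rangle+\frac{L}{2}\|\mathbf{y}-\mathbf{x}\|_2^2$. Block-$k$ stationary point: $\mathbf{x}$ is a block-$k$ stationary point if for every $B\subseteq\{1,\dots,n\}$ with $|B|=k$, $\mathbf{x}\in\arg\min_{\mathbf{z}}\{F(\mathbf{z}):\mathbf{z}_{\bar B}=\mathbf{x}_{\bar B}\}$. *)

theory Defs
  imports "HOL-Analysis.Analysis"
begin

definition l0_norm :: "real ^ 'n \<Rightarrow> nat"
  where "l0_norm x = card {i. x $ i \<noteq> 0}"

datatype sparse_problem = Constrained nat | Regularized real

fun penalty :: "sparse_problem \<Rightarrow> real ^ 'n \<Rightarrow> ereal"
  where
    "penalty (Constrained s) x = (if l0_norm x \<le> s then 0 else \<infinity>)"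
  | "penalty (Regularized lam) x = ereal (lam * real (l0_norm x))"

definition objective :: "(real ^ 'n \<Rightarrow> real) \<Rightarrow> sparse_problem \<Rightarrow> real ^ 'n \<Rightarrow> ereal"
  where "objective f P x = ereal (f x) + penalty P x"

text \<open>Meaningful only at points where \<open>f\<close> is differentiable; there the vector is unique.\<close>

definition gradient :: "(real ^ 'n \<Rightarrow> real) \<Rightarrow> real ^ 'n \<Rightarrow> real ^ 'n"
  where "gradient f x = (THE D. GDERIV f x :> D)"

definition minimizes_on_support :: "(real ^ 'n \<Rightarrow> real) \<Rightarrow> real ^ 'n \<Rightarrow> bool"
  where "minimizes_on_support f x \<longleftrightarrow>
    is_arg_min f (\<lambda>y. \<forall>i \<in> {i. x $ i = 0}. y $ i = 0) x"

fun basic_stationary :: "(real ^ 'n \<Rightarrow> real) \<Rightarrow> sparse_problem \<Rightarrow> real ^ 'n \<Rightarrow> bool"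
  where
    "basic_stationary f (Constrained s) x \<longleftrightarrow>
       card {j. x $ j \<noteq> 0} \<le> s \<and> minimizes_on_support f x"
  | "basic_stationary f (Regularized lam) x \<longleftrightarrow> minimizes_on_support f x"

definition quadratic_model ::
    "(real ^ 'n \<Rightarrow> real) \<Rightarrow> real \<Rightarrow> real ^ 'n \<Rightarrow> real ^ 'n \<Rightarrow> real"
  where "quadratic_model f L y x =
    f x + gradient f x \<bullet> (y - x) + L / 2 * (norm (y - x))\<^sup>2"

definition L_stationary ::
    "(real ^ 'n \<Rightarrow> real) \<Rightarrow> sparse_problem \<Rightarrow> real \<Rightarrow> real ^ 'n \<Rightarrow> bool"
  where "L_stationary f P L x \<longleftrightarrow>
    is_arg_min (\<lambda>y. ereal (quadratic_model f L y x) + penalty P y) (\<lambda>_. True) x"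

definition block_stationary ::
    "(real ^ 'n \<Rightarrow> real) \<Rightarrow> sparse_problem \<Rightarrow> nat \<Rightarrow> real ^ 'n \<Rightarrow> bool"
  where "block_stationary f P k x \<longleftrightarrow>
    (\<forall>B. card B = k \<longrightarrow> is_arg_min (objective f P) (\<lambda>z. \<forall>i \<in> - B. z $ i = x $ i) x)"

definition optimal_point :: "(real ^ 'n \<Rightarrow> real) \<Rightarrow> sparse_problem \<Rightarrow> real ^ 'n \<Rightarrow> bool"
  where "optimal_point f P x \<longleftrightarrow> is_arg_min (objective f P) (\<lambda>_. True) x"

end

theory Submission
  imports Defs
begin

text \<open>
  Write \<open>g\<close> for the gradient of \<open>f\<close> at \<open>x\<close>.  Two inequalities relate \<open>f\<close> to its linearisation at
  \<open>x\<close>: convexity puts \<open>f\<close> above it (\<open>convex_ge_linearization\<close>), and the Lipschitz gradient puts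
  \<open>f\<close> below \<open>quadratic_model f L\<close> (\<open>le_quadratic_model\<close>).

  An L-stationary point minimises the model in particular over the \<open>y\<close> supported in the support of
  \<open>x\<close>, where the penalty cannot exceed its value at \<open>x\<close>.  A quadratic \<open>a t + (L/2) t\<^sup>2\<close> that never
  drops below its value at \<open>t = 0\<close> has \<open>a = 0\<close>, so \<open>g\<close> is orthogonal to all those directions, and by
  convexity \<open>x\<close> minimises \<open>f\<close> over them.

  Conversely, since the model majorises \<open>f\<close> and touches it at \<open>x\<close>, a point that cannot be improved
  for \<open>F\<close> by changing at most \<open>k\<close> coordinates cannot be improved for the penalised model either
  (\<open>block_stationary_model\<close>).  The model, however, is separable, and this promotes optimality under
  changes of very few coordinates to global optimality.  With the regularising penalty the whole
  objective is a sum over coordinates, so single coordinate changes suffice, and likewise with the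
  sparsity constraint if the support of \<open>x\<close> has fewer than \<open>s\<close> elements.
  If it has exactly \<open>s\<close>, a new coordinate can enter only if another one leaves; an
  arbitrary competitor \<open>y\<close> decomposes into such swaps because at least as many
  coordinates leave the support as enter it (\<open>sum_nonneg_if_swaps_nonneg\<close>). This is
  where \<open>k \<ge> 2\<close> is used.

  The comparisons among the block conditions all follow from the description of block-\<open>k\<close> stationarity
  as optimality against every point that differs from \<open>x\<close> in at most \<open>k\<close> coordinates
  (\<open>block_stationary_iff\<close>).
\<close>

section \<open>Gradients, linearisations and the quadratic upper bound\<close>

lemma gderiv_gradient:
  fixes f :: "real ^ 'n \<Rightarrow> real"
  assumes "f differentiable (at x)"
  shows "GDERIV f x :> gradient f x"
proof -
  obtain f' where f': "(f has_derivative f') (at x)"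
    using assms by (auto simp: differentiable_def)
  interpret linear f' using f' by (rule has_derivative_linear)
  \<comment> \<open>The adjoint of a functional, applied to \<open>1\<close>, is its Riesz representative.\<close>
  have "f' = (\<lambda>h. h \<bullet> adjoint f' 1)"
    using adjoint_works[OF linear_axioms, of _ 1] by simp
  then have D: "GDERIV f x :> adjoint f' 1"
    using f' by (simp add: gderiv_def)
  have "D' = adjoint f' 1" if "GDERIV f x :> D'" for D'
  proof -
    have "(\<lambda>h. h \<bullet> D') = (\<lambda>h. h \<bullet> adjoint f' 1)"
      using that D unfolding gderiv_def by (rule has_derivative_unique)
    then show ?thesis by (metis vector_eq_ldot)
  qed
  then show ?thesis
    unfolding gradient_def using D by (metis theI)
qed

lemma gradient_along_line:
  fixes f :: "real ^ 'n \<Rightarrow> real"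
  assumes "\<forall>y. f differentiable (at y)"
  shows "((\<lambda>t. f (x + t *\<^sub>R d)) has_real_derivative (gradient f (x + t *\<^sub>R d) \<bullet> d)) (at t within A)"
proof -
  have f: "(f has_derivative (\<lambda>h. h \<bullet> gradient f (x + t *\<^sub>R d))) (at (x + t *\<^sub>R d))"
    using gderiv_gradient[of f "x + t *\<^sub>R d"] assms by (simp add: gderiv_def)
  have "((\<lambda>t. x + t *\<^sub>R d) has_derivative (\<lambda>h. h *\<^sub>R d)) (at t within A)"
    by (auto intro!: derivative_eq_intros)
  from has_derivative_compose[OF this f] show ?thesis
    unfolding has_field_derivative_def
    by (rule has_derivative_eq_rhs) (auto simp: inner_commute)
qed

lemma convex_ge_linearization:
  fixes f :: "real ^ 'n \<Rightarrow> real"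
  assumes conv: "convex_on UNIV f" and diff: "\<forall>y. f differentiable (at y)"
  shows "f y \<ge> f x + gradient f x \<bullet> (y - x)"
proof -
  define d where "d = y - x"
  have "convex_on UNIV (\<lambda>t. f (x + t *\<^sub>R d))"
  proof (rule convex_onI)
    fix u a b :: real
    assume "0 < u" "u < 1"
    have "x + ((1 - u) *\<^sub>R a + u *\<^sub>R b) *\<^sub>R d = (1 - u) *\<^sub>R (x + a *\<^sub>R d) + u *\<^sub>R (x + b *\<^sub>R d)"
      by (simp add: algebra_simps)
    with convex_onD[OF conv, of u "x + a *\<^sub>R d" "x + b *\<^sub>R d"] \<open>0 < u\<close> \<open>u < 1\<close>
    show "f (x + ((1 - u) *\<^sub>R a + u *\<^sub>R b) *\<^sub>R d)
        \<le> (1 - u) * f (x + a *\<^sub>R d) + u * f (x + b *\<^sub>R d)" by simp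
  qed simp
  from convex_on_imp_above_tangent[OF this _ _ _ gradient_along_line[OF diff], of 0 1]
  show ?thesis by (simp add: d_def)
qed

text \<open>
  The Lipschitz bound and Cauchy--Schwarz bound the derivative of
  \<open>t \<mapsto> f (x + t d)\<close> on \<open>[0, 1]\<close> by the derivative \<open>g \<bullet> d + L t \<parallel>d\<parallel>\<^sup>2\<close> of the model, so the
  difference of the two sides is monotone along the segment.
\<close>

lemma le_quadratic_model:
  fixes f :: "real ^ 'n \<Rightarrow> real"
  assumes diff: "\<forall>y. f differentiable (at y)" and lip: "lipschitz_on L UNIV (gradient f)"
  shows "f y \<le> quadratic_model f L y x"
proof -
  define d where "d = y - x"
  define \<phi> where "\<phi> t = f (x + t *\<^sub>R d) - t * (gradient f x \<bullet> d) - L / 2 * t\<^sup>2 * (norm d)\<^sup>2" for t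
  define \<phi>' where "\<phi>' t = gradient f (x + t *\<^sub>R d) \<bullet> d - gradient f x \<bullet> d - L * t * (norm d)\<^sup>2" for t
  have "\<phi> 1 \<le> \<phi> 0"
  proof (rule DERIV_nonpos_imp_nonincreasing[of 0 1])
    fix t :: real
    assume t: "0 \<le> t" "t \<le> 1"
    have "(\<phi> has_real_derivative \<phi>' t) (at t)"
      unfolding \<phi>_def \<phi>'_def
      by (rule derivative_eq_intros gradient_along_line diff refl | simp)+
    moreover have "\<phi>' t \<le> 0"
    proof -
      have "(gradient f (x + t *\<^sub>R d) - gradient f x) \<bullet> d
          \<le> norm (gradient f (x + t *\<^sub>R d) - gradient f x) * norm d"
        by (rule norm_cauchy_schwarz)
      also have "\<dots> \<le> (L * (t * norm d)) * norm d"
        using lipschitz_onD[OF lip, of "x + t *\<^sub>R d" x] t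
        by (intro mult_right_mono) (auto simp: dist_norm)
      finally show ?thesis
        by (simp add: \<phi>'_def inner_diff_left power2_eq_square mult.assoc)
    qed
    ultimately show "\<exists>D. (\<phi> has_real_derivative D) (at t) \<and> D \<le> 0" by blast
  qed simp
  then show ?thesis by (simp add: \<phi>_def d_def quadratic_model_def)
qed

text \<open>
  The terms are normalised to vanish at \<open>x $ i\<close>, so that comparing \<open>x\<close> with a point \<open>z\<close> involves
  only the coordinates in which the two differ.
\<close>

definition coordinate_model ::
    "(real ^ 'n \<Rightarrow> real) \<Rightarrow> real \<Rightarrow> real ^ 'n \<Rightarrow> 'n \<Rightarrow> real \<Rightarrow> real"
  where "coordinate_model f L x i t = gradient f x $ i * (t - x $ i) + L / 2 * (t - x $ i)\<^sup>2"

lemma coordinate_model_self [simp]: "coordinate_model f L x i (x $ i) = 0"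
  by (simp add: coordinate_model_def)

lemma quadratic_model_separable:
  "quadratic_model f L y x = f x + (\<Sum>i\<in>UNIV. coordinate_model f L x i (y $ i))"
proof -
  have "(norm (y - x))\<^sup>2 = (\<Sum>i\<in>UNIV. (y $ i - x $ i)\<^sup>2)"
    unfolding power2_norm_eq_inner by (simp add: inner_vec_def power2_eq_square)
  then show ?thesis
    by (simp add: quadratic_model_def coordinate_model_def inner_vec_def sum.distrib sum_distrib_left)
qed

lemma quadratic_model_self [simp]: "quadratic_model f L x x = f x"
  by (simp add: quadratic_model_def)

section \<open>L-stationary points are basic stationary\<close>

text \<open>
  Near \<open>0\<close> the linear term dominates.  The step \<open>t = - a / (1 + \<bar>c\<bar>)\<close> is short enough to make the
  left-hand side negative for either sign of \<open>c\<close>, unless \<open>a = 0\<close>.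
\<close>

lemma linear_coeff_eq_0:
  fixes a c :: real
  assumes nonneg: "\<And>t. 0 \<le> a * t + c * t\<^sup>2"
  shows "a = 0"
proof -
  define r where "r = 1 + \<bar>c\<bar>"
  have r: "r > 0" "c < r" by (auto simp: r_def)
  have "0 \<le> a * (- a / r) + c * (- a / r)\<^sup>2" by (rule nonneg)
  also have "\<dots> = (a / r)\<^sup>2 * (c - r)"
    using r by (simp add: field_simps power2_eq_square)
  finally have "(a / r)\<^sup>2 \<le> 0"
    using r by (simp add: zero_le_mult_iff)
  with r show ?thesis by simp
qed

lemma penalty_mono:
  assumes supp: "{i. y $ i \<noteq> 0} \<subseteq> {i. x $ i \<noteq> 0}"
    and "\<And>lam. P = Regularized lam \<Longrightarrow> lam \<ge> 0"
  shows "penalty P y \<le> penalty P x"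
proof -
  have "l0_norm y \<le> l0_norm x"
    unfolding l0_norm_def using supp by (intro card_mono) auto
  with assms(2) show ?thesis
    by (cases P) (auto intro: mult_left_mono)
qed

lemma L_stationary_imp_minimizes_on_support:
  fixes f :: "real ^ 'n \<Rightarrow> real"
  assumes conv: "convex_on UNIV f" and diff: "\<forall>y. f differentiable (at y)"
    and lam: "\<And>lam. P = Regularized lam \<Longrightarrow> lam \<ge> 0"
    and finite_penalty: "penalty P x < \<infinity>"
    and stat: "L_stationary f P L x"
  shows "minimizes_on_support f x"
proof -
  have "f x \<le> f y" if supp: "\<forall>i \<in> {i. x $ i = 0}. y $ i = 0" for y
  proof -
    have "0 \<le> (gradient f x \<bullet> (y - x)) * t + (L / 2 * (norm (y - x))\<^sup>2) * t\<^sup>2" for t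
    proof -
      define z where "z = x + t *\<^sub>R (y - x)"
      have le: "penalty P z \<le> penalty P x"
        using supp by (intro penalty_mono lam) (auto simp: z_def)
      have "ereal (f x) + penalty P x \<le> ereal (quadratic_model f L z x) + penalty P z"
        using stat by (auto simp: L_stationary_def is_arg_min_def not_less)
      also have "\<dots> \<le> ereal (quadratic_model f L z x) + penalty P x"
        using le by (rule add_left_mono)
      finally have "f x \<le> quadratic_model f L z x"
        using finite_penalty by (cases P) (auto split: if_splits)
      then show ?thesis
        by (simp add: quadratic_model_def z_def power_mult_distrib mult_ac)
    qed
    then have "gradient f x \<bullet> (y - x) = 0" by (rule linear_coeff_eq_0)
    with convex_ge_linearization[OF conv diff, of x y] show ?thesis by simp
  qed
  then show ?thesis
    by (auto simp: minimizes_on_support_def is_arg_min_def not_less)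
qed

section \<open>Block stationarity as optimality against few changed coordinates\<close>

text \<open>
  A set of at most \<open>k\<close> changed coordinates extends to a block of size exactly \<open>k\<close>, which is possible
  because \<open>k\<close> does not exceed the dimension.
\<close>

lemma block_stationary_iff:
  fixes x :: "real ^ 'n"
  assumes "k \<le> CARD('n)"
  shows "block_stationary f P k x \<longleftrightarrow>
    (\<forall>z. card {i. z $ i \<noteq> x $ i} \<le> k \<longrightarrow> objective f P x \<le> objective f P z)"
    (is "_ \<longleftrightarrow> ?R")
proof
  assume stat: "block_stationary f P k x"
  show ?R
  proof (intro allI impI)
    fix z :: "real ^ 'n"
    assume "card {i. z $ i \<noteq> x $ i} \<le> k"
    then obtain B where "{i. z $ i \<noteq> x $ i} \<subseteq> B" "card B = k"
      using exists_subset_between[of "{i. z $ i \<noteq> x $ i}" k UNIV] assms by auto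
    with stat show "objective f P x \<le> objective f P z"
      by (auto simp: block_stationary_def is_arg_min_def not_less)
  qed
next
  assume R: ?R
  show "block_stationary f P k x"
    unfolding block_stationary_def
  proof (intro allI impI)
    fix B :: "'n set"
    assume B: "card B = k"
    have "objective f P x \<le> objective f P z" if "\<forall>i \<in> - B. z $ i = x $ i" for z
    proof -
      have "card {i. z $ i \<noteq> x $ i} \<le> card B"
        using that by (intro card_mono) auto
      with R B show ?thesis by simp
    qed
    then show "is_arg_min (objective f P) (\<lambda>z. \<forall>i \<in> - B. z $ i = x $ i) x"
      by (auto simp: is_arg_min_def not_less)
  qed
qed

lemma block_stationary_antimono:
  fixes x :: "real ^ 'n"
  assumes "block_stationary f P k x" "j \<le> k" "k \<le> CARD('n)"
  shows "block_stationary f P j x"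
  using assms by (auto simp: block_stationary_iff)

lemma block_stationary_CARD_iff_optimal:
  fixes x :: "real ^ 'n"
  shows "block_stationary f P CARD('n) x \<longleftrightarrow> optimal_point f P x"
  by (auto simp: block_stationary_iff optimal_point_def is_arg_min_def not_less card_mono)

section \<open>Block stationary points are L-stationary\<close>

lemma block_stationary_model:
  fixes f :: "real ^ 'n \<Rightarrow> real"
  assumes "\<forall>y. f differentiable (at y)" "lipschitz_on L UNIV (gradient f)"
    and "block_stationary f P k x" "k \<le> CARD('n)"
    and "card {i. z $ i \<noteq> x $ i} \<le> k"
  shows "penalty P x \<le> ereal (\<Sum>i\<in>UNIV. coordinate_model f L x i (z $ i)) + penalty P z"
proof -
  have "ereal (f x) + penalty P x \<le> ereal (f z) + penalty P z"
    using assms by (auto simp: block_stationary_iff objective_def)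
  also have "\<dots> \<le> ereal (quadratic_model f L z x) + penalty P z"
    using le_quadratic_model[OF assms(1,2)] by (intro add_right_mono) simp
  finally show ?thesis
    by (cases P) (auto simp: quadratic_model_separable split: if_splits)
qed

lemma L_stationaryI:
  assumes "\<And>y. penalty P x \<le> ereal (\<Sum>i\<in>UNIV. coordinate_model f L x i (y $ i)) + penalty P y"
  shows "L_stationary f P L x"
proof -
  have "ereal (quadratic_model f L x x) + penalty P x
      \<le> ereal (quadratic_model f L y x) + penalty P y" for y
    using assms[of y] by (cases P) (auto simp: quadratic_model_separable split: if_splits)
  then show ?thesis by (auto simp: L_stationary_def is_arg_min_def not_less)
qed

lemma l0_norm_eq_sum: "real (l0_norm y) = (\<Sum>i\<in>UNIV. of_bool (y $ i \<noteq> 0))"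
  by (simp add: l0_norm_def)

lemma sum_change_one:
  fixes q :: "'n::finite \<Rightarrow> real \<Rightarrow> real"
  shows "(\<Sum>j\<in>UNIV. q j ((\<chi> j. if j = i then t else x $ j) $ j))
    = (\<Sum>j\<in>UNIV. q j (x $ j)) - q i (x $ i) + q i t"
proof -
  have "(\<Sum>j\<in>UNIV. q j ((\<chi> j. if j = i then t else x $ j) $ j)) = q i t + (\<Sum>j\<in>UNIV - {i}. q j (x $ j))"
    by (subst sum.remove[of _ i]) (auto intro!: sum.cong)
  then show ?thesis by (simp add: sum.remove[of UNIV i "\<lambda>j. q j (x $ j)"])
qed

lemma block_stationary_imp_L_stationary_Regularized:
  fixes f :: "real ^ 'n \<Rightarrow> real"
  assumes diff: "\<forall>y. f differentiable (at y)" and lip: "lipschitz_on L UNIV (gradient f)"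
    and stat: "block_stationary f (Regularized lam) k x" and k: "1 \<le> k" "k \<le> CARD('n)"
  shows "L_stationary f (Regularized lam) L x"
proof -
  define q where "q i t = coordinate_model f L x i t + lam * of_bool (t \<noteq> 0)" for i t
  have sum_q: "(\<Sum>i\<in>UNIV. q i (y $ i))
      = (\<Sum>i\<in>UNIV. coordinate_model f L x i (y $ i)) + lam * real (l0_norm y)" for y
    by (simp add: q_def l0_norm_eq_sum sum.distrib sum_distrib_left del: sum_of_bool_eq)
  have q_min: "q i (x $ i) \<le> q i t" for i t
  proof -
    define z where "z = (\<chi> j. if j = i then t else x $ j)"
    have "card {j. z $ j \<noteq> x $ j} \<le> card {i}"
      by (intro card_mono) (auto simp: z_def)
    with k have "card {j. z $ j \<noteq> x $ j} \<le> k" by simp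
    from block_stationary_model[OF diff lip stat k(2) this]
    have "(\<Sum>j\<in>UNIV. q j (x $ j)) \<le> (\<Sum>j\<in>UNIV. q j (z $ j))"
      by (simp add: sum_q)
    then show ?thesis by (simp add: z_def sum_change_one del: vec_lambda_beta)
  qed
  show ?thesis
  proof (rule L_stationaryI)
    fix y
    have "(\<Sum>i\<in>UNIV. q i (x $ i)) \<le> (\<Sum>i\<in>UNIV. q i (y $ i))"
      by (intro sum_mono q_min)
    then show "penalty (Regularized lam) x
        \<le> ereal (\<Sum>i\<in>UNIV. coordinate_model f L x i (y $ i)) + penalty (Regularized lam) y"
      by (simp add: sum_q)
  qed
qed

text \<open>
  Since \<open>card T \<le> card S\<close>, the entering indices \<open>T - S\<close> can be matched injectively with leaving
  indices in \<open>S - T\<close>.  Each matched pair contributes a nonnegative swap, and every index of \<open>S\<close>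
  left over contributes a nonnegative term of its own.
\<close>

lemma sum_nonneg_if_swaps_nonneg:
  fixes q :: "'i \<Rightarrow> real"
  assumes fin: "finite S" "finite T" and card: "card T \<le> card S"
    and S: "\<And>i. i \<in> S \<Longrightarrow> 0 \<le> q i"
    and swap: "\<And>i j. i \<in> S - T \<Longrightarrow> j \<in> T - S \<Longrightarrow> 0 \<le> q i + q j"
  shows "0 \<le> (\<Sum>i\<in>S \<union> T. q i)"
proof -
  have "card (T - S) \<le> card (S - T)"
    using card fin by (simp add: card_Diff_subset_Int Int_commute)
  then obtain \<phi> where \<phi>: "inj_on \<phi> (T - S)" "\<phi> ` (T - S) \<subseteq> S - T"
    using card_le_inj[of "T - S" "S - T"] fin by auto
  have "0 \<le> (\<Sum>j\<in>T - S. q (\<phi> j) + q j)"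
    using \<phi>(2) by (intro sum_nonneg swap) auto
  also have "\<dots> = sum q (\<phi> ` (T - S)) + sum q (T - S)"
    using \<phi>(1) by (simp add: sum.distrib sum.reindex)
  also have "sum q (\<phi> ` (T - S)) \<le> sum q S"
    using \<phi>(2) S fin by (intro sum_mono2) auto
  also have "sum q S + sum q (T - S) = sum q (S \<union> T)"
    using fin by (simp flip: sum.union_disjoint)
  finally show ?thesis by simp
qed

lemma block_stationary_imp_L_stationary_Constrained:
  fixes f :: "real ^ 'n \<Rightarrow> real"
  assumes diff: "\<forall>y. f differentiable (at y)" and lip: "lipschitz_on L UNIV (gradient f)"
    and stat: "block_stationary f (Constrained s) k x" and k: "2 \<le> k" "k \<le> CARD('n)"
    and sparse: "l0_norm x \<le> s"
  shows "L_stationary f (Constrained s) L x"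
proof -
  let ?q = "coordinate_model f L x"
  define S where "S = {i. x $ i \<noteq> 0}"
  have card_S: "card S \<le> s" using sparse by (simp add: S_def l0_norm_def)
  have few: "0 \<le> (\<Sum>i\<in>UNIV. ?q i (z $ i))"
    if "card {i. z $ i \<noteq> x $ i} \<le> k" "l0_norm z \<le> s" for z
    using block_stationary_model[OF diff lip stat k(2) that(1)] that(2) sparse by simp
  have single: "0 \<le> ?q i t" if i: "i \<in> S \<or> card S < s" for i t
  proof -
    define z where "z = (\<chi> j. if j = i then t else x $ j)"
    have "card {j. z $ j \<noteq> x $ j} \<le> card {i}"
      by (intro card_mono) (auto simp: z_def)
    moreover have "l0_norm z \<le> card (insert i S)"
      unfolding l0_norm_def by (intro card_mono) (auto simp: z_def S_def)
    moreover have "card (insert i S) \<le> s"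
      using i card_S by (auto simp: insert_absorb card_insert_if)
    ultimately have "0 \<le> (\<Sum>j\<in>UNIV. ?q j (z $ j))"
      using k by (intro few) auto
    then show ?thesis by (simp add: z_def sum_change_one del: vec_lambda_beta)
  qed
  \<comment> \<open>Removing \<open>i\<close> from the support makes room for \<open>j\<close>; this changes two coordinates.\<close>
  have swap: "0 \<le> ?q i 0 + ?q j t" if ij: "i \<in> S" "j \<notin> S" for i j t
  proof -
    define w where "w = (\<chi> l. if l = i then 0 else x $ l)"
    define z where "z = (\<chi> l. if l = j then t else w $ l)"
    have "card {l. z $ l \<noteq> x $ l} \<le> card {i, j}"
      by (intro card_mono) (auto simp: z_def w_def)
    also have "\<dots> \<le> 2" using card_insert_le_m1[of 2 "{j}" i] by simp
    finally have "card {l. z $ l \<noteq> x $ l} \<le> k" using k by simp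
    moreover have "l0_norm z \<le> card (insert j (S - {i}))"
      unfolding l0_norm_def by (intro card_mono) (auto simp: z_def w_def S_def)
    moreover have "card (insert j (S - {i})) = card S"
      using ij card_Suc_Diff1[of S i] by simp
    ultimately have "0 \<le> (\<Sum>l\<in>UNIV. ?q l (z $ l))"
      using card_S by (intro few) auto
    moreover have "w $ j = x $ j" using ij by (auto simp: w_def)
    moreover have "(\<Sum>l\<in>UNIV. ?q l (w $ l)) = ?q i 0"
      by (simp add: w_def sum_change_one del: vec_lambda_beta)
    ultimately show ?thesis by (simp add: z_def sum_change_one del: vec_lambda_beta)
  qed
  have "0 \<le> (\<Sum>i\<in>UNIV. ?q i (y $ i))" if y: "l0_norm y \<le> s" for y
  proof (cases "card S < s")
    case True
    then show ?thesis by (intro sum_nonneg single) simp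
  next
    case False
    define T where "T = {i. y $ i \<noteq> 0}"
    have "card T \<le> card S" using y False by (simp add: T_def l0_norm_def)
    then have "0 \<le> (\<Sum>i\<in>S \<union> T. ?q i (y $ i))"
    proof (rule sum_nonneg_if_swaps_nonneg[rotated 2])
      fix i j assume ij: "i \<in> S - T" "j \<in> T - S"
      then have "y $ i = 0" by (simp add: T_def)
      then show "0 \<le> ?q i (y $ i) + ?q j (y $ j)" using swap[of i j] ij by simp
    qed (auto intro: single)
    also have "\<dots> = (\<Sum>i\<in>UNIV. ?q i (y $ i))"
    proof (rule sum.mono_neutral_left)
      \<comment> \<open>Outside both supports the coordinate does not move, so its term vanishes.\<close>
      show "\<forall>i\<in>UNIV - (S \<union> T). ?q i (y $ i) = 0"
        by (auto simp: S_def T_def coordinate_model_def)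
    qed auto
    finally show ?thesis .
  qed
  then show ?thesis
    using sparse by (intro L_stationaryI) simp
qed

section \<open>The hierarchy of stationarity conditions\<close>

theorem proposition1:
  fixes f :: "real ^ 'n \<Rightarrow> real" and P :: sparse_problem
    and L lam :: real and s k :: nat and x :: "real ^ 'n"
  assumes "convex_on UNIV f"
    and "\<forall>y. f differentiable (at y)"
    and "lipschitz_on L UNIV (gradient f)"
    and "s \<in> {1..CARD('n)}" and "lam > 0"
    and "k \<in> {1..CARD('n)}"
    and "(P = Constrained s \<and> k \<ge> 2) \<or> (P = Regularized lam \<and> k \<ge> 1)"
    and feasible: "objective f P x < \<infinity>"
  shows "(L_stationary f P L x \<longrightarrow> basic_stationary f P x)
    \<and> (block_stationary f P k x \<longrightarrow> L_stationary f P L x)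
    \<and> (k + 1 \<le> CARD('n) \<longrightarrow> block_stationary f P (k + 1) x \<longrightarrow> block_stationary f P k x)
    \<and> (\<forall>j \<in> {k..<CARD('n)}. block_stationary f P (j + 1) x \<longrightarrow> block_stationary f P j x)
    \<and> (block_stationary f P CARD('n) x \<longleftrightarrow> optimal_point f P x)"
proof (intro conjI impI ballI)
  have finite_penalty: "penalty P x < \<infinity>"
    using feasible by (auto simp: objective_def)
  have k: "k \<le> CARD('n)" using assms(6) by simp
  have lam: "lam' \<ge> 0" if "P = Regularized lam'" for lam'
    using assms(5,7) that by auto
  show "basic_stationary f P x" if "L_stationary f P L x"
    using L_stationary_imp_minimizes_on_support[OF assms(1,2) lam finite_penalty that] finite_penalty
    by (cases P) (auto simp: l0_norm_def split: if_splits)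
  show "L_stationary f P L x" if stat: "block_stationary f P k x"
    using assms(7)
  proof
    assume P: "P = Constrained s \<and> k \<ge> 2"
    then have "l0_norm x \<le> s" using finite_penalty by (auto split: if_splits)
    then show ?thesis
      using block_stationary_imp_L_stationary_Constrained[OF assms(2,3) _ _ k] stat P by simp
  next
    assume "P = Regularized lam \<and> k \<ge> 1"
    then show ?thesis
      using block_stationary_imp_L_stationary_Regularized[OF assms(2,3) _ _ k] stat by simp
  qed
  show "block_stationary f P k x" if "k + 1 \<le> CARD('n)" "block_stationary f P (k + 1) x"
    using block_stationary_antimono[OF that(2) _ that(1)] by simp
  show "block_stationary f P j x"
    if "j \<in> {k..<CARD('n)}" "block_stationary f P (j + 1) x" for j
    using block_stationary_antimono[OF that(2)] that(1) by simp
  show "block_stationary f P CARD('n) x \<longleftrightarrow> optimal_point f P x"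
    by (rule block_stationary_CARD_iff_optimal)
qed

end
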